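(* Let $f\in L^1(\mathbb{T})$ and $t\in\mathbb{T}$. If $$\int_{-\pi}^{\pi}\left|\frac{f(t-\tau)-f(t)}{\tau}\right|d\tau<\infty,$$ then the Fourier series of $f$ converges at $t$ to $f(t)$, that is, $\lim_{n\to\infty}S_n(f)(t)=f(t)$.
   Context: $\mathbb{T}=\mathbb{R}/2\pi\mathbb{Z}$; $f$ is a complex-valued $2\pi$-periodic integrable function. $\hat f(j)=\frac{1}{2\pi}\int_{\mathbb{T}}f(s)e^{-ijs}\,ds$ and $S_n(f)(t)=\sum_{j=-n}^n\hat f(j)e^{ijt}$. *)

theory Defs
  imports "HOL-Analysis.Analysis"
begin

text \<open>
  A function on the circle \<open>\<real>/2\<pi>\<int>\<close> is represented by a function on the real line of period \<open>2\<pi>\<close>,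
  and \<open>\<integral>\<close> over the circle by the Lebesgue integral over the period \<open>[-\<pi>, \<pi>]\<close>. Functions are
  not identified up to null sets: values at individual points matter for pointwise convergence.
\<close>

definition L1_circle :: "(real \<Rightarrow> complex) set" where
  "L1_circle = {f. (\<forall>x. f (x + 2 * pi) = f x) \<and> set_integrable lebesgue {-pi..pi} f}"

definition fourier_coeff :: "(real \<Rightarrow> complex) \<Rightarrow> int \<Rightarrow> complex" where
  "fourier_coeff f j =
     1 / (2 * of_real pi) * (LINT s:{-pi..pi}|lebesgue. f s * exp (- \<i> * of_int j * of_real s))"

definition fourier_sum :: "nat \<Rightarrow> (real \<Rightarrow> complex) \<Rightarrow> real \<Rightarrow> complex" where
  "fourier_sum n f t = (\<Sum>j = - int n..int n. fourier_coeff f j * exp (\<i> * of_int j * of_real t))"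

end

theory Submission
  imports Defs
begin

text \<open>
  The idea is to divide by \<open>exp (\<i>\<tau>) - 1\<close> so that the partial sums telescope. Put
  \<open>g \<tau> = (f (t - \<tau>) - f t) / (exp (\<i>\<tau>) - 1)\<close> and let \<open>A j\<close> be the integral of
  \<open>g \<tau> * exp (\<i>j\<tau>)\<close> over a period. On \<open>[-\<pi>, \<pi>]\<close> the denominator is at least \<open>\<bar>\<tau>\<bar> / 3\<close> in
  absolute value (\<open>norm_exp_i_minus_1_ge\<close>), so that the hypothesis on the difference quotient
  makes \<open>g\<close> integrable (\<open>dini_quotient_integrable\<close>).

  By periodicity, the \<open>j\<close>-th term of the Fourier series of \<open>f\<close> at \<open>t\<close> is the mean of
  \<open>f (t - \<tau>) * exp (\<i>j\<tau>)\<close> (\<open>fourier_term_eq_integral\<close>). Since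
  \<open>f (t - \<tau>) = f t + g \<tau> * (exp (\<i>\<tau>) - 1)\<close>, the constant \<open>f t\<close> contributes to the term \<open>j = 0\<close> only,
  and the rest of the \<open>j\<close>-th term is \<open>(A (j + 1) - A j) / 2\<pi>\<close>. Summing over \<open>\<bar>j\<bar> \<le> n\<close> gives
  \<open>S\<^sub>n f t - f t = (A (n + 1) - A (-n)) / 2\<pi>\<close>, which tends to \<open>0\<close> by the Riemann--Lebesgue lemma
  (\<open>riemann_lebesgue_circle\<close>).

  The Riemann--Lebesgue lemma itself comes from Bessel's inequality (\<open>bessel_bounded\<close>), which settles
  bounded functions, and from truncation: the integrable functions are the \<open>L\<^sup>1\<close>-limits of their
  truncations, and the functions integrated against are bounded by \<open>1\<close>. This argument works for every
  uniformly bounded orthogonal sequence on a finite measure space.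
\<close>

section \<open>Bounded orthogonal sequences and integrable functions\<close>

lemma borel_measurable_cnj [measurable]:
  "f \<in> borel_measurable M \<Longrightarrow> (\<lambda>x. cnj (f x)) \<in> borel_measurable M"
  by (rule borel_measurable_continuous_on[of cnj]) (intro continuous_intros)

text \<open>
  Bessel's inequality. Instead of expanding the square of the distance from \<open>g\<close> to its orthogonal
  projection \<open>P\<close>, the proof compares \<open>\<langle>g, P\<rangle>\<close> and \<open>\<langle>P, P\<rangle>\<close>: these agree, and the pointwise
  arithmetic--geometric mean inequality bounds the first by half of \<open>\<langle>g, g\<rangle> + \<langle>P, P\<rangle>\<close>. Boundedness of
  \<open>g\<close> makes every product that occurs integrable.
\<close>

lemma bessel_bounded:
  fixes e :: "nat \<Rightarrow> 'a \<Rightarrow> complex" and g :: "'a \<Rightarrow> complex"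
  assumes "finite_measure M"
    and e_meas [measurable]: "\<And>n. e n \<in> borel_measurable M"
    and e_bound: "\<And>n x. norm (e n x) \<le> 1"
    and orth: "\<And>m n. (\<integral>x. e m x * cnj (e n x) \<partial>M) = (if m = n then of_real C else 0)"
    and "C > 0"
    and g_meas [measurable]: "g \<in> borel_measurable M"
    and g_bound: "\<And>x. norm (g x) \<le> B"
  shows "(\<Sum>n<N. (norm (\<integral>x. g x * cnj (e n x) \<partial>M))\<^sup>2) \<le> C * (\<integral>x. (norm (g x))\<^sup>2 \<partial>M)"
proof -
  interpret finite_measure M by fact
  define a where "a n = (\<integral>x. g x * cnj (e n x) \<partial>M)" for n
  \<comment> \<open>\<open>P\<close> is \<open>C\<close> times the orthogonal projection, which keeps the sums free of division.\<close>
  define P where "P x = (\<Sum>n<N. a n * e n x)" for x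
  define S where "S = (\<Sum>n<N. (norm (a n))\<^sup>2)"
  have B0: "0 \<le> B" using g_bound[of undefined] norm_ge_zero order_trans by blast
  have P_meas [measurable]: "P \<in> borel_measurable M"
    unfolding P_def by measurable
  have int_ge: "integrable M (\<lambda>x. g x * cnj (e n x))" for n
  proof (rule integrable_const_bound[where B="B * 1"])
    show "AE x in M. norm (g x * cnj (e n x)) \<le> B * 1"
      unfolding norm_mult complex_mod_cnj
      by (intro AE_I2 mult_mono g_bound e_bound B0 norm_ge_zero)
  qed measurable
  have int_ee: "integrable M (\<lambda>x. e m x * cnj (e n x))" for m n
  proof (rule integrable_const_bound[where B="1 * 1"])
    show "AE x in M. norm (e m x * cnj (e n x)) \<le> 1 * 1"
      unfolding norm_mult complex_mod_cnj
      by (intro AE_I2 mult_mono e_bound norm_ge_zero zero_le_one)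
  qed measurable
  have sq: "a n * cnj (a n) = of_real ((norm (a n))\<^sup>2)" for n
    by (simp only: complex_norm_square)
  have gP: "g x * cnj (P x) = (\<Sum>n<N. cnj (a n) * (g x * cnj (e n x)))" for x
    by (simp add: P_def sum_distrib_left mult_ac)
  have int_gP: "integrable M (\<lambda>x. g x * cnj (P x))"
    unfolding gP by (intro Bochner_Integration.integrable_sum integrable_mult_right int_ge)
  have I_gP: "(\<integral>x. g x * cnj (P x) \<partial>M) = of_real S"
  proof -
    have "(\<integral>x. g x * cnj (P x) \<partial>M) = (\<Sum>n<N. cnj (a n) * a n)"
      unfolding gP a_def[symmetric]
      by (subst Bochner_Integration.integral_sum) (auto intro: int_ge simp: a_def)
    then show ?thesis by (simp add: S_def sq mult.commute)
  qed
  have PP: "P x * cnj (P x) = (\<Sum>m<N. \<Sum>n<N. (a m * cnj (a n)) * (e m x * cnj (e n x)))" for x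
    by (simp add: P_def sum_product mult_ac)
  have int_PP: "integrable M (\<lambda>x. P x * cnj (P x))"
    unfolding PP by (intro Bochner_Integration.integrable_sum integrable_mult_right int_ee)
  have I_PP: "(\<integral>x. P x * cnj (P x) \<partial>M) = of_real (C * S)"
  proof -
    have "(\<integral>x. P x * cnj (P x) \<partial>M)
        = (\<Sum>m<N. \<Sum>n<N. (a m * cnj (a n)) * (if m = n then of_real C else 0))"
      unfolding PP
      by (subst Bochner_Integration.integral_sum, (auto intro!: int_ee)[1],
          subst Bochner_Integration.integral_sum, (auto intro!: int_ee)[1], simp add: orth)
    also have "\<dots> = (\<Sum>m<N. a m * cnj (a m) * of_real C)"
      by (intro sum.cong refl) (simp add: if_distrib cong: if_cong)
    also have "\<dots> = of_real (C * S)"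
      unfolding sq S_def by (simp add: sum_distrib_left mult.commute)
    finally show ?thesis .
  qed
  have int_g2: "integrable M (\<lambda>x. (norm (g x))\<^sup>2)"
    by (rule integrable_const_bound[where B="B\<^sup>2"])
      (use g_bound in \<open>auto intro!: power_mono AE_I2\<close>)
  have P2: "(norm (P x))\<^sup>2 = Re (P x * cnj (P x))" for x
    by (simp add: complex_norm_square[symmetric])
  have int_P2: "integrable M (\<lambda>x. (norm (P x))\<^sup>2)"
    unfolding P2 using int_PP by (rule integrable_Re)
  have I_P2: "(\<integral>x. (norm (P x))\<^sup>2 \<partial>M) = C * S"
    unfolding P2 using integral_Re[OF int_PP] I_PP by simp
  have pw: "2 * C * Re (g x * cnj (P x)) \<le> C\<^sup>2 * (norm (g x))\<^sup>2 + (norm (P x))\<^sup>2" for x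
  proof -
    have "Re (g x * cnj (P x)) \<le> norm (g x) * norm (P x)"
      using complex_Re_le_cmod[of "g x * cnj (P x)"] by (simp add: norm_mult)
    then have "2 * C * Re (g x * cnj (P x)) \<le> 2 * C * (norm (g x) * norm (P x))"
      using \<open>C > 0\<close> by simp
    also have "\<dots> \<le> C\<^sup>2 * (norm (g x))\<^sup>2 + (norm (P x))\<^sup>2"
      using zero_le_power2[of "C * norm (g x) - norm (P x)"]
      by (simp add: power2_eq_square algebra_simps)
    finally show ?thesis .
  qed
  have "2 * C * S = (\<integral>x. 2 * C * Re (g x * cnj (P x)) \<partial>M)"
    using integral_Re[OF int_gP] I_gP by simp
  also have "\<dots> \<le> (\<integral>x. C\<^sup>2 * (norm (g x))\<^sup>2 + (norm (P x))\<^sup>2 \<partial>M)"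
    by (intro integral_mono integrable_mult_right integrable_Re int_gP Bochner_Integration.integrable_add
          int_g2 int_P2 pw)
  also have "\<dots> = C\<^sup>2 * (\<integral>x. (norm (g x))\<^sup>2 \<partial>M) + C * S"
    using int_g2 int_P2 by (simp add: I_P2)
  finally have "C * S \<le> C * (C * (\<integral>x. (norm (g x))\<^sup>2 \<partial>M))"
    by (simp add: power2_eq_square)
  with \<open>C > 0\<close> show ?thesis by (simp add: S_def a_def)
qed

text \<open>
  For bounded \<open>g\<close> the squares of the coefficients are summable by Bessel's inequality, so the
  coefficients tend to \<open>0\<close>. Replacing an integrable \<open>g\<close> by a truncation changes all coefficients at once
  by no more than the \<open>L\<^sup>1\<close>-distance, which dominated convergence makes arbitrarily small.
\<close>

lemma riemann_lebesgue_orthogonal: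
  fixes e :: "nat \<Rightarrow> 'a \<Rightarrow> complex" and g :: "'a \<Rightarrow> complex"
  assumes "finite_measure M"
    and e_meas [measurable]: "\<And>n. e n \<in> borel_measurable M"
    and e_bound: "\<And>n x. norm (e n x) \<le> 1"
    and orth: "\<And>m n. (\<integral>x. e m x * cnj (e n x) \<partial>M) = (if m = n then of_real C else 0)"
    and "C > 0"
    and g: "integrable M g"
  shows "(\<lambda>n. \<integral>x. g x * cnj (e n x) \<partial>M) \<longlonglongrightarrow> 0"
proof -
  interpret finite_measure M by fact
  have g_meas [measurable]: "g \<in> borel_measurable M" using g by simp
  define h where "h K x = (if norm (g x) \<le> real K then g x else 0)" for K :: nat and x
  have h_meas [measurable]: "h K \<in> borel_measurable M" for K
    unfolding h_def by measurable
  have h_bound: "norm (h K x) \<le> real K" for K x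
    by (simp add: h_def)
  have h_le: "norm (h K x) \<le> norm (g x)" for K x
    by (simp add: h_def)
  have int_h: "integrable M (h K)" for K
    by (rule Bochner_Integration.integrable_bound[OF g]) (auto simp: h_le)
  have h_coeff: "(\<lambda>n. \<integral>x. h K x * cnj (e n x) \<partial>M) \<longlonglongrightarrow> 0" for K
  proof -
    have "summable (\<lambda>n. (norm (\<integral>x. h K x * cnj (e n x) \<partial>M))\<^sup>2)"
      by (rule summableI_nonneg_bounded)
        (use bessel_bounded[OF \<open>finite_measure M\<close> e_meas e_bound orth \<open>C > 0\<close> h_meas h_bound] in auto)
    then have "(\<lambda>n. (norm (\<integral>x. h K x * cnj (e n x) \<partial>M))\<^sup>2) \<longlonglongrightarrow> 0"
      by (rule summable_LIMSEQ_zero)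
    then have "(\<lambda>n. norm (\<integral>x. h K x * cnj (e n x) \<partial>M)) \<longlonglongrightarrow> 0"
      using tendsto_real_sqrt by fastforce
    then show ?thesis by (rule tendsto_norm_zero_cancel)
  qed
  have L1: "(\<lambda>K. \<integral>x. norm (g x - h K x) \<partial>M) \<longlonglongrightarrow> 0"
  proof -
    have "(\<lambda>K. \<integral>x. norm (g x - h K x) \<partial>M) \<longlonglongrightarrow> (\<integral>x. 0 \<partial>M)"
    proof (rule integral_dominated_convergence[where w="\<lambda>x. norm (g x)"])
      show "AE x in M. (\<lambda>K. norm (g x - h K x)) \<longlonglongrightarrow> 0"
      proof (rule AE_I2)
        fix x
        obtain K0 :: nat where K0: "norm (g x) \<le> real K0" using real_arch_simple by blast
        have "\<forall>\<^sub>F K in sequentially. norm (g x - h K x) = 0"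
          using eventually_ge_at_top[of K0] by eventually_elim (use K0 in \<open>auto simp: h_def\<close>)
        then show "(\<lambda>K. norm (g x - h K x)) \<longlonglongrightarrow> 0" by (rule tendsto_eventually)
      qed
    qed (use g in \<open>auto simp: h_def\<close>)
    then show ?thesis by simp
  qed
  show ?thesis
  proof (rule LIMSEQ_I)
    fix r :: real assume "r > 0"
    obtain K where K: "(\<integral>x. norm (g x - h K x) \<partial>M) < r / 2"
      using order_tendstoD(2)[OF L1, of "r/2"] \<open>r > 0\<close> eventually_happens'[OF sequentially_bot]
      by auto
    have "\<forall>\<^sub>F n in sequentially. norm (\<integral>x. h K x * cnj (e n x) \<partial>M) < r / 2"
      using order_tendstoD(2)[OF tendsto_norm_zero[OF h_coeff], of "r/2"] \<open>r > 0\<close> by simp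
    then obtain N where N: "\<And>n. n \<ge> N \<Longrightarrow> norm (\<integral>x. h K x * cnj (e n x) \<partial>M) < r / 2"
      by (auto simp: eventually_sequentially)
    have "norm ((\<integral>x. g x * cnj (e n x) \<partial>M) - 0) < r" if "n \<ge> N" for n
    proof -
      have int_mult: "integrable M (\<lambda>x. u x * cnj (e n x))" if "integrable M u" for u :: "'a \<Rightarrow> complex"
      proof (rule Bochner_Integration.integrable_bound[OF that])
        have [measurable]: "u \<in> borel_measurable M" using that by simp
        show "(\<lambda>x. u x * cnj (e n x)) \<in> borel_measurable M" by measurable
        show "AE x in M. norm (u x * cnj (e n x)) \<le> norm (u x)"
          using e_bound by (auto simp: norm_mult intro!: mult_left_le)
      qed
      have d: "integrable M (\<lambda>x. g x - h K x)" using g int_h by simp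
      have "(\<integral>x. g x * cnj (e n x) \<partial>M)
          = (\<integral>x. (g x - h K x) * cnj (e n x) \<partial>M) + (\<integral>x. h K x * cnj (e n x) \<partial>M)"
        by (subst Bochner_Integration.integral_add[symmetric])
          (use int_mult[OF d] int_mult[OF int_h] in \<open>simp_all add: left_diff_distrib\<close>)
      also have "norm \<dots> \<le> norm (\<integral>x. (g x - h K x) * cnj (e n x) \<partial>M)
          + norm (\<integral>x. h K x * cnj (e n x) \<partial>M)"
        by (rule norm_triangle_ineq)
      also have "norm (\<integral>x. (g x - h K x) * cnj (e n x) \<partial>M) \<le> (\<integral>x. norm (g x - h K x) \<partial>M)"
      proof (rule order_trans[OF integral_norm_bound integral_mono])
        show "norm ((g x - h K x) * cnj (e n x)) \<le> norm (g x - h K x)" for x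
          using e_bound[of n x] by (simp add: norm_mult mult_left_le)
      qed (intro integrable_norm int_mult[OF d] d)+
      finally show ?thesis using K N[OF that] by simp
    qed
    then show "\<exists>no. \<forall>n\<ge>no. norm ((\<integral>x. g x * cnj (e n x) \<partial>M) - 0) < r" by blast
  qed
qed

section \<open>Trigonometric exponentials on a period\<close>

lemma integral_exp_int:
  "(\<integral>s. exp (\<i> * of_int j * of_real s) \<partial>lebesgue_on {-pi..pi}) = (if j = 0 then 2 * of_real pi else 0)"
proof -
  have abs: "(\<lambda>s. exp (\<i> * of_int j * of_real s)) absolutely_integrable_on {-pi..pi}"
    by (intro absolutely_integrable_continuous_real continuous_intros)
  have eq: "(\<integral>s. exp (\<i> * of_int j * of_real s) \<partial>lebesgue_on {-pi..pi})
      = integral {-pi..pi} (\<lambda>s. exp (\<i> * of_int j * of_real s))"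
    using set_lebesgue_integral_eq_integral(2)[OF abs]
    by (simp add: integral_restrict_space set_lebesgue_integral_def)
  show ?thesis
  proof (cases "j = 0")
    case True
    then show ?thesis by (simp add: measure_restrict_space scaleR_conv_of_real)
  next
    case False
    have "((\<lambda>s. exp (\<i> * of_int j * of_real s)) has_integral
        (exp (\<i> * of_int j * of_real pi) / (\<i> * of_int j)
         - exp (\<i> * of_int j * of_real (-pi)) / (\<i> * of_int j))) {-pi..pi}"
    proof (rule fundamental_theorem_of_calculus)
      fix x :: real
      have "((\<lambda>z. exp (\<i> * of_int j * z) / (\<i> * of_int j)) has_field_derivative
          exp (\<i> * of_int j * of_real x)) (at (of_real x))"
        using False by (auto intro!: derivative_eq_intros)
      then show "((\<lambda>s. exp (\<i> * of_int j * of_real s) / (\<i> * of_int j)) has_vector_derivative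
          exp (\<i> * of_int j * of_real x)) (at x within {-pi..pi})"
        by (rule has_vector_derivative_real_field)
    qed simp
    moreover have "exp (\<i> * of_int j * of_real pi) = exp (\<i> * of_int j * of_real (-pi))"
      unfolding exp_eq by (rule exI[of _ j]) simp
    ultimately show ?thesis using False eq by (simp add: integral_unique)
  qed
qed

text \<open>
  Injectivity of \<open>k\<close> is what turns the exponentials into an orthogonal sequence; it covers
  frequencies that tend to \<open>\<infinity>\<close> and to \<open>-\<infinity>\<close> alike.
\<close>

lemma riemann_lebesgue_circle:
  fixes g :: "real \<Rightarrow> complex" and k :: "nat \<Rightarrow> int"
  assumes "inj k" and g: "integrable (lebesgue_on {-pi..pi}) g"
  shows "(\<lambda>n. \<integral>s. g s * exp (\<i> * of_int (k n) * of_real s) \<partial>lebesgue_on {-pi..pi}) \<longlonglongrightarrow> 0"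
proof -
  \<comment> \<open>The frequency is negated because the coefficients are taken against the conjugate of \<open>e\<close>.\<close>
  define e :: "nat \<Rightarrow> real \<Rightarrow> complex" where "e n s = exp (\<i> * of_int (- k n) * of_real s)" for n s
  have cnj_e: "cnj (e n s) = exp (\<i> * of_int (k n) * of_real s)" for n s
    by (simp add: e_def exp_cnj)
  have "(\<lambda>n. \<integral>s. g s * cnj (e n s) \<partial>lebesgue_on {-pi..pi}) \<longlonglongrightarrow> 0"
  proof (rule riemann_lebesgue_orthogonal[OF _ _ _ _ _ g, where C="2 * pi"])
    show "finite_measure (lebesgue_on {-pi..pi})"
      by (rule finite_measure_lebesgue_on) simp
    show "e n \<in> borel_measurable (lebesgue_on {-pi..pi})" for n
      unfolding e_def by (intro continuous_imp_measurable_on_sets_lebesgue continuous_intros) simp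
    show "norm (e n s) \<le> 1" for n s
      by (simp add: e_def)
    show "(\<integral>s. e m s * cnj (e n s) \<partial>lebesgue_on {-pi..pi})
        = (if m = n then of_real (2 * pi) else 0)" for m n
    proof -
      have "e m s * cnj (e n s) = exp (\<i> * of_int (k n - k m) * of_real s)" for s
        unfolding cnj_e by (simp add: e_def exp_add[symmetric] algebra_simps)
      then show ?thesis
        using integral_exp_int[of "k n - k m"] \<open>inj k\<close> by (auto simp: inj_eq)
    qed
  qed simp
  then show ?thesis by (simp add: cnj_e)
qed

text \<open>
  A chord of the unit circle is comparable to its arc. The length of the chord is
  \<open>2 * \<bar>sin (x / 2)\<bar>\<close>, and the cubic error bound for the sine already suffices: with \<open>y = x / 2\<close> and
  \<open>\<bar>y\<bar> \<le> \<pi> / 2 \<le> 2\<close> it gives \<open>\<bar>sin y\<bar> \<ge> \<bar>y\<bar> * (1 - 4 / 6)\<close>.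
\<close>

lemma norm_exp_i_minus_1_ge:
  fixes x :: real
  assumes "\<bar>x\<bar> \<le> pi"
  shows "\<bar>x\<bar> / 3 \<le> norm (exp (\<i> * of_real x) - 1)"
proof -
  define y where "y = x / 2"
  have y: "\<bar>y\<bar> \<le> 2" using assms pi_less_4 by (simp add: y_def)
  have "\<bar>sin y - (\<Sum>m<3. sin_coeff m * y ^ m)\<bar> \<le> inverse (fact 3) * \<bar>y\<bar> ^ 3"
    by (rule Maclaurin_sin_bound)
  then have "\<bar>sin y - y\<bar> \<le> \<bar>y\<bar> ^ 3 / 6"
    by (simp add: eval_nat_numeral sin_coeff_def)
  also have "\<bar>y\<bar> ^ 3 / 6 \<le> \<bar>y\<bar> * (2 * 2) / 6"
    using mult_left_mono[OF mult_mono[OF y y], of "\<bar>y\<bar>"] by (simp add: power3_eq_cube mult.assoc)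
  finally have "\<bar>y\<bar> / 3 \<le> \<bar>sin y\<bar>" by linarith
  then show ?thesis by (simp add: dist_exp_i_1 y_def)
qed

section \<open>Integrals of periodic functions\<close>

text \<open>
  A multiple of the period moves the first interval to \<open>[c, c + p)\<close> with \<open>c \<le> b < c + p\<close>. Then
  \<open>[b, b + p)\<close> arises from \<open>[c, c + p)\<close> by cutting off \<open>[c, b)\<close> and pasting its translate by \<open>p\<close> at
  the other end. Half-open intervals make these decompositions exact.
\<close>

lemma has_bochner_integral_period_shift:
  fixes h :: "real \<Rightarrow> 'a :: euclidean_space"
  assumes "p > 0" and per: "\<And>x. h (x + p) = h x"
    and I: "has_bochner_integral lebesgue (\<lambda>x. indicator {a..<a + p} x *\<^sub>R h x) I"
  shows "has_bochner_integral lebesgue (\<lambda>x. indicator {b..<b + p} x *\<^sub>R h x) I"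
proof -
  have per_nat: "h (x + real n * p) = h x" for x n
  proof (induction n)
    case (Suc n)
    then show ?case using per[of "x + real n * p"] by (simp add: algebra_simps)
  qed simp
  have per_int: "h (x + of_int k * p) = h x" for x k
    using per_nat[of x "nat k"] per_nat[of "x + of_int k * p" "nat (- k)"]
    by (cases "k \<ge> 0") simp_all
  have translate: "has_bochner_integral lebesgue (\<lambda>x. indicator {u + of_int k * p..<v + of_int k * p} x *\<^sub>R h x) J"
    if "has_bochner_integral lebesgue (\<lambda>x. indicator {u..<v} x *\<^sub>R h x) J" for u v J and k :: int
  proof -
    have "indicator {u + of_int k * p..<v + of_int k * p} (of_int k * p + 1 * x)
          *\<^sub>R h (of_int k * p + 1 * x) = indicator {u..<v} x *\<^sub>R h x" for x
      using per_int[of x k] by (auto simp: indicator_def add.commute)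
    then show ?thesis
      using that by (subst has_bochner_integral_lebesgue_real_affine_iff[where c=1 and t="of_int k * p"]) simp_all
  qed
  define k where "k = \<lfloor>(b - a) / p\<rfloor>"
  define c where "c = a + of_int k * p"
  have "of_int k \<le> (b - a) / p" "(b - a) / p < of_int k + 1"
    unfolding k_def by linarith+
  then have c: "c \<le> b" "b < c + p"
    using \<open>p > 0\<close> by (simp_all add: c_def field_simps)
  have Jc: "has_bochner_integral lebesgue (\<lambda>x. indicator {c..<c + p} x *\<^sub>R h x) I"
    using translate[OF I, of k] by (simp add: c_def algebra_simps)
  have sub: "integrable lebesgue (\<lambda>x. indicator {u..<v} x *\<^sub>R h x)" if "{u..<v} \<subseteq> {c..<c + p}" for u v
  proof -
    have "integrable lebesgue (\<lambda>x. indicator {u..<v} x *\<^sub>R (indicator {c..<c + p} x *\<^sub>R h x))"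
      using Jc by (intro integrable_mult_indicator[of "{u..<v}" lebesgue]) (simp_all only: has_bochner_integral_iff, simp)
    moreover have "indicator {u..<v} x *\<^sub>R (indicator {c..<c + p} x *\<^sub>R h x) = indicator {u..<v} x *\<^sub>R h x" for x
      using that by (auto simp: indicator_def)
    ultimately show ?thesis by (simp only:)
  qed
  obtain J1 J2 where
    J1: "has_bochner_integral lebesgue (\<lambda>x. indicator {c..<b} x *\<^sub>R h x) J1" and
    J2: "has_bochner_integral lebesgue (\<lambda>x. indicator {b..<c + p} x *\<^sub>R h x) J2"
    using sub[of c b] sub[of b "c + p"] c by (auto simp: integrable.simps)
  have "has_bochner_integral lebesgue
      (\<lambda>x. indicator {c..<b} x *\<^sub>R h x + indicator {b..<c + p} x *\<^sub>R h x) (J1 + J2)"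
    by (rule has_bochner_integral_add[OF J1 J2])
  moreover have "indicator {c..<b} x *\<^sub>R h x + indicator {b..<c + p} x *\<^sub>R h x
      = indicator {c..<c + p} x *\<^sub>R h x" for x
    using c by (auto simp: indicator_def)
  ultimately have I_eq: "I = J1 + J2"
    using Jc has_bochner_integral_eq by fastforce
  have J1': "has_bochner_integral lebesgue (\<lambda>x. indicator {c + p..<b + p} x *\<^sub>R h x) J1"
    using translate[OF J1, of 1] by simp
  have "has_bochner_integral lebesgue
      (\<lambda>x. indicator {c + p..<b + p} x *\<^sub>R h x + indicator {b..<c + p} x *\<^sub>R h x) (J1 + J2)"
    by (rule has_bochner_integral_add[OF J1' J2])
  moreover have "indicator {c + p..<b + p} x *\<^sub>R h x + indicator {b..<c + p} x *\<^sub>R h x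
      = indicator {b..<b + p} x *\<^sub>R h x" for x
    using c by (auto simp: indicator_def)
  ultimately show ?thesis by (simp add: I_eq)
qed

lemma has_bochner_integral_circle_reflect:
  fixes h :: "real \<Rightarrow> 'a :: euclidean_space"
  assumes per: "\<And>x. h (x + 2 * pi) = h x"
    and I: "has_bochner_integral (lebesgue_on {-pi..pi}) h I"
  shows "has_bochner_integral (lebesgue_on {-pi..pi}) (\<lambda>x. h (t - x)) I"
proof -
  have "has_bochner_integral lebesgue (\<lambda>x. indicator {-pi..pi} x *\<^sub>R h x) I"
    using I by (simp add: has_bochner_integral_restrict_space)
  then have "has_bochner_integral lebesgue (\<lambda>x. indicator {-pi..<-pi + 2 * pi} x *\<^sub>R h x) I"
    by (subst has_bochner_integral_discrete_difference[where X="{pi}" and g="\<lambda>x. indicator {-pi..pi} x *\<^sub>R h x"])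
      (auto simp: indicator_def)
  from has_bochner_integral_period_shift[OF _ per this, of "t - pi"]
  have "has_bochner_integral lebesgue (\<lambda>x. indicator {t - pi..<t + pi} x *\<^sub>R h x) I"
    by (simp add: algebra_simps)
  then have "has_bochner_integral lebesgue
      (\<lambda>x. indicator {t - pi..<t + pi} (t + (-1) * x) *\<^sub>R h (t + (-1) * x)) (I /\<^sub>R \<bar>-1\<bar>)"
    by (subst has_bochner_integral_lebesgue_real_affine_iff[symmetric]) auto
  then have "has_bochner_integral lebesgue (\<lambda>x. indicator {-pi..pi} x *\<^sub>R h (t - x)) I"
    by (subst has_bochner_integral_discrete_difference[where X="{-pi}"
          and g="\<lambda>x. indicator {t - pi..<t + pi} (t + (-1) * x) *\<^sub>R h (t + (-1) * x)"])
      (auto simp: indicator_def)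
  then show ?thesis by (simp add: has_bochner_integral_restrict_space)
qed

section \<open>Dini's test\<close>

text \<open>
  At \<open>\<tau> = 0\<close> both quotients have denominator \<open>0\<close> and hence the value \<open>0\<close>, so the comparison of the two
  holds at every point of the interval.
\<close>

lemma dini_quotient_integrable:
  fixes f :: "real \<Rightarrow> complex"
  assumes f: "integrable (lebesgue_on {-pi..pi}) (\<lambda>\<tau>. f (t - \<tau>))"
    and dini: "(\<integral>\<^sup>+ \<tau>\<in>{-pi..pi}. ennreal (norm ((f (t - \<tau>) - f t) / of_real \<tau>)) \<partial>lebesgue) < \<infinity>"
  shows "integrable (lebesgue_on {-pi..pi}) (\<lambda>\<tau>. (f (t - \<tau>) - f t) / (exp (\<i> * of_real \<tau>) - 1))"
proof -
  let ?M = "lebesgue_on {-pi..pi}"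
  have [measurable]: "(\<lambda>\<tau>. f (t - \<tau>)) \<in> borel_measurable ?M" using f by simp
  have cont: "u \<in> borel_measurable ?M" if "continuous_on {-pi..pi} u" for u :: "real \<Rightarrow> complex"
    using that by (rule continuous_imp_measurable_on_sets_lebesgue) simp
  have [measurable]: "(\<lambda>\<tau>. of_real \<tau> :: complex) \<in> borel_measurable ?M"
    "(\<lambda>\<tau>. exp (\<i> * of_real \<tau>) - 1 :: complex) \<in> borel_measurable ?M"
    by (intro cont continuous_intros)+
  have q: "integrable ?M (\<lambda>\<tau>. 3 * ((f (t - \<tau>) - f t) / of_real \<tau>))"
  proof (rule integrable_mult_right, rule integrableI_bounded)
    show "(\<lambda>\<tau>. (f (t - \<tau>) - f t) / of_real \<tau>) \<in> borel_measurable ?M" by measurable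
    show "(\<integral>\<^sup>+ \<tau>. ennreal (norm ((f (t - \<tau>) - f t) / of_real \<tau>)) \<partial>?M) < \<infinity>"
      using dini by (simp add: nn_integral_restrict_space)
  qed
  show ?thesis
  proof (rule Bochner_Integration.integrable_bound[OF q])
    show "(\<lambda>\<tau>. (f (t - \<tau>) - f t) / (exp (\<i> * of_real \<tau>) - 1)) \<in> borel_measurable ?M"
      by measurable
    show "AE \<tau> in ?M. norm ((f (t - \<tau>) - f t) / (exp (\<i> * of_real \<tau>) - 1))
        \<le> norm (3 * ((f (t - \<tau>) - f t) / of_real \<tau>))"
    proof (rule AE_I2)
      fix \<tau> assume "\<tau> \<in> space ?M"
      then have le: "\<bar>\<tau>\<bar> / 3 \<le> norm (exp (\<i> * of_real \<tau>) - 1)"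
        by (intro norm_exp_i_minus_1_ge) auto
      show "norm ((f (t - \<tau>) - f t) / (exp (\<i> * of_real \<tau>) - 1))
        \<le> norm (3 * ((f (t - \<tau>) - f t) / of_real \<tau>))"
      proof (cases "\<tau> = 0")
        case False
        have "norm (f (t - \<tau>) - f t) / norm (exp (\<i> * of_real \<tau>) - 1)
            \<le> norm (f (t - \<tau>) - f t) / (\<bar>\<tau>\<bar> / 3)"
          using le False by (intro divide_left_mono) (auto intro!: mult_pos_pos)
        then show ?thesis by (simp add: norm_divide norm_mult mult.commute del: right_diff_distrib_numeral left_diff_distrib_numeral)
      qed simp
    qed
  qed
qed

text \<open>
  The integrand \<open>f s * exp (\<i>j(t - s))\<close> of the \<open>j\<close>-th term is itself periodic in \<open>s\<close>, so the
  substitution \<open>s = t - \<tau>\<close> does not move the period over which it is integrated.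
\<close>

lemma fourier_term_eq_integral:
  assumes f: "f \<in> L1_circle"
  shows "integrable (lebesgue_on {-pi..pi}) (\<lambda>\<tau>. f (t - \<tau>) * exp (\<i> * of_int j * of_real \<tau>))"
    and "fourier_coeff f j * exp (\<i> * of_int j * of_real t)
      = 1 / (2 * of_real pi) * (\<integral>\<tau>. f (t - \<tau>) * exp (\<i> * of_int j * of_real \<tau>) \<partial>lebesgue_on {-pi..pi})"
proof -
  let ?M = "lebesgue_on {-pi..pi}"
  have per_f: "f (x + 2 * pi) = f x" for x
    using f by (simp add: L1_circle_def)
  have f_int: "integrable ?M f"
    using f by (simp add: L1_circle_def set_integrable_def integrable_restrict_space)
  define h where "h s = f s * exp (\<i> * of_int j * of_real (t - s))" for s
  have per_h: "h (x + 2 * pi) = h x" for x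
  proof -
    have "exp (\<i> * of_int j * of_real (t - (x + 2 * pi))) = exp (\<i> * of_int j * of_real (t - x))"
      unfolding exp_eq by (rule exI[of _ "- j"]) (simp add: algebra_simps)
    then show ?thesis by (simp add: h_def per_f)
  qed
  have [measurable]: "f \<in> borel_measurable ?M" using f_int by simp
  have [measurable]: "(\<lambda>s. exp (\<i> * of_int j * of_real (t - s))) \<in> borel_measurable ?M"
    by (intro continuous_imp_measurable_on_sets_lebesgue continuous_intros) simp
  have h_int: "integrable ?M h"
  proof (rule Bochner_Integration.integrable_bound[OF f_int])
    show "h \<in> borel_measurable ?M" unfolding h_def by measurable
    have "norm (exp (\<i> * of_int j * complex_of_real (t - s))) = 1" for s
      using norm_exp_i_times[of "of_int j * (t - s)"] by (simp add: mult.assoc)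
    then show "AE s in ?M. norm (h s) \<le> norm (f s)"
      by (simp add: h_def norm_mult)
  qed
  have "has_bochner_integral ?M (\<lambda>\<tau>. h (t - \<tau>)) (\<integral>s. h s \<partial>?M)"
    by (rule has_bochner_integral_circle_reflect[where h=h, OF per_h]) (simp add: has_bochner_integral_integrable h_int)
  then have reflected: "has_bochner_integral ?M (\<lambda>\<tau>. f (t - \<tau>) * exp (\<i> * of_int j * of_real \<tau>)) (\<integral>s. h s \<partial>?M)"
    by (simp add: h_def)
  then show "integrable ?M (\<lambda>\<tau>. f (t - \<tau>) * exp (\<i> * of_int j * of_real \<tau>))"
    by (simp add: has_bochner_integral_iff)
  have "(LINT s:{-pi..pi}|lebesgue. f s * exp (- \<i> * of_int j * of_real s)) * exp (\<i> * of_int j * of_real t)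
      = (\<integral>s. f s * exp (- \<i> * of_int j * of_real s) * exp (\<i> * of_int j * of_real t) \<partial>?M)"
    by (simp add: set_lebesgue_integral_def integral_restrict_space)
  also have "\<dots> = (\<integral>s. h s \<partial>?M)"
  proof (rule Bochner_Integration.integral_cong[OF refl])
    fix s
    have "exp (- \<i> * of_int j * of_real s) * exp (\<i> * of_int j * of_real t)
        = exp (\<i> * of_int j * of_real (t - s))"
      by (simp add: exp_add[symmetric] algebra_simps)
    then show "f s * exp (- \<i> * of_int j * of_real s) * exp (\<i> * of_int j * of_real t) = h s"
      by (simp only: h_def mult.assoc)
  qed
  also have "\<dots> = (\<integral>\<tau>. f (t - \<tau>) * exp (\<i> * of_int j * of_real \<tau>) \<partial>?M)"
    using reflected by (simp add: has_bochner_integral_iff)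
  finally show "fourier_coeff f j * exp (\<i> * of_int j * of_real t)
      = 1 / (2 * of_real pi) * (\<integral>\<tau>. f (t - \<tau>) * exp (\<i> * of_int j * of_real \<tau>) \<partial>?M)"
    by (simp add: fourier_coeff_def mult.assoc)
qed

theorem theorem8p3:
  fixes f :: "real \<Rightarrow> complex" and t :: real
  assumes "f \<in> L1_circle"
    and "(\<integral>\<^sup>+ \<tau>\<in>{-pi..pi}. ennreal (norm ((f (t - \<tau>) - f t) / of_real \<tau>)) \<partial>lebesgue) < \<infinity>"
  shows "(\<lambda>n. fourier_sum n f t) \<longlonglongrightarrow> f t"
proof -
  let ?M = "lebesgue_on {-pi..pi}"
  define g where "g \<tau> = (f (t - \<tau>) - f t) / (exp (\<i> * of_real \<tau>) - 1)" for \<tau>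
  define A where "A j = (\<integral>\<tau>. g \<tau> * exp (\<i> * of_int j * of_real \<tau>) \<partial>?M)" for j
  have g: "integrable ?M g"
    unfolding g_def using fourier_term_eq_integral(1)[OF assms(1), of t 0] assms(2)
    by (intro dini_quotient_integrable) simp_all
  have exp_meas [measurable]: "(\<lambda>\<tau>. exp (\<i> * of_int j * complex_of_real \<tau>)) \<in> borel_measurable ?M" for j
    by (intro continuous_imp_measurable_on_sets_lebesgue continuous_intros) simp
  have int_mult: "integrable ?M (\<lambda>\<tau>. u \<tau> * exp (\<i> * of_int j * of_real \<tau>))"
    if "integrable ?M u" for u :: "real \<Rightarrow> complex" and j
  proof (rule Bochner_Integration.integrable_bound[OF that])
    have [measurable]: "u \<in> borel_measurable ?M" using that by simp
    show "(\<lambda>\<tau>. u \<tau> * exp (\<i> * of_int j * of_real \<tau>)) \<in> borel_measurable ?M" by measurable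
    show "AE \<tau> in ?M. norm (u \<tau> * exp (\<i> * of_int j * of_real \<tau>)) \<le> norm (u \<tau>)"
      using norm_exp_i_times[of "of_int j * _"] by (simp add: norm_mult mult.assoc)
  qed
  have fin: "finite_measure ?M" by (rule finite_measure_lebesgue_on) simp
  \<comment> \<open>This includes \<open>\<tau> = 0\<close>, where both sides vanish.\<close>
  have factor: "f (t - \<tau>) - f t = g \<tau> * (exp (\<i> * of_real \<tau>) - 1)" if "\<tau> \<in> {-pi..pi}" for \<tau>
  proof (cases "\<tau> = 0")
    case False
    with that norm_exp_i_minus_1_ge[of \<tau>] have "exp (\<i> * of_real \<tau>) \<noteq> 1"
      by (auto simp: abs_le_iff)
    then show ?thesis by (simp add: g_def)
  qed simp
  have "fourier_sum n f t - f t = 1 / (2 * of_real pi) * (A (int n + 1) - A (- int n))" for n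
  proof -
    have coeff: "(\<integral>\<tau>. f (t - \<tau>) * exp (\<i> * of_int j * of_real \<tau>) \<partial>?M)
        = (if j = 0 then 2 * of_real pi * f t else 0) + (A (j + 1) - A j)" for j
    proof -
      have "(\<integral>\<tau>. f (t - \<tau>) * exp (\<i> * of_int j * of_real \<tau>) \<partial>?M)
          = (\<integral>\<tau>. f t * exp (\<i> * of_int j * of_real \<tau>)
              + (g \<tau> * exp (\<i> * of_int (j + 1) * of_real \<tau>) - g \<tau> * exp (\<i> * of_int j * of_real \<tau>)) \<partial>?M)"
      proof (rule Bochner_Integration.integral_cong[OF refl])
        fix \<tau> assume "\<tau> \<in> space ?M"
        then have "f (t - \<tau>) = f t + g \<tau> * (exp (\<i> * of_real \<tau>) - 1)"
          using factor[of \<tau>] by (auto simp: diff_eq_eq add.commute)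
        moreover have "exp (\<i> * of_int (j + 1) * of_real \<tau>)
            = exp (\<i> * of_real \<tau>) * exp (\<i> * of_int j * of_real \<tau>)"
          by (simp add: exp_add[symmetric] algebra_simps)
        ultimately show "f (t - \<tau>) * exp (\<i> * of_int j * of_real \<tau>)
            = f t * exp (\<i> * of_int j * of_real \<tau>)
              + (g \<tau> * exp (\<i> * of_int (j + 1) * of_real \<tau>) - g \<tau> * exp (\<i> * of_int j * of_real \<tau>))"
          by (simp add: ring_distribs del: of_int_add)
      qed
      also have "\<dots> = f t * (\<integral>\<tau>. exp (\<i> * of_int j * of_real \<tau>) \<partial>?M) + (A (j + 1) - A j)"
        unfolding A_def
        using int_mult[OF g, of j] int_mult[OF g, of "j + 1"]
          int_mult[OF finite_measure.integrable_const[OF fin], of "f t" j]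
        by (subst Bochner_Integration.integral_add) (simp_all del: of_int_add)
      finally show ?thesis by (simp add: integral_exp_int)
    qed
    have tele: "(\<Sum>j = - int n..int n. A (j + 1) - A j) = A (int n + 1) - A (- int n)"
    proof (induction n)
      case (Suc n)
      have "{- int (Suc n)..int (Suc n)} = insert (- int (Suc n)) (insert (int (Suc n)) {- int n..int n})"
        by auto
      then show ?case using Suc by (simp add: add.commute)
    qed simp
    have "fourier_sum n f t = 1 / (2 * of_real pi) *
        (\<Sum>j = - int n..int n. (if j = 0 then 2 * of_real pi * f t else 0) + (A (j + 1) - A j))"
      unfolding fourier_sum_def fourier_term_eq_integral(2)[OF assms(1)] coeff
      by (simp only: sum_distrib_left)
    also have "\<dots> = 1 / (2 * of_real pi) * (2 * of_real pi * f t + (A (int n + 1) - A (- int n)))"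
      by (simp add: sum.distrib tele)
    finally show ?thesis by (simp add: field_simps)
  qed
  moreover have "(\<lambda>n. 1 / (2 * of_real pi) * (A (int n + 1) - A (- int n))) \<longlonglongrightarrow> 1 / (2 * of_real pi) * (0 - 0)"
    unfolding A_def
    by (intro tendsto_intros riemann_lebesgue_circle[OF _ g, of "\<lambda>n. int n + 1"]
        riemann_lebesgue_circle[OF _ g, of "\<lambda>n. - int n"]) (auto simp: inj_def)
  ultimately have "(\<lambda>n. fourier_sum n f t - f t) \<longlonglongrightarrow> 0" by simp
  then show ?thesis by (simp add: LIM_zero_iff)
qed

end
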